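(* Let $\sigma:(0,\infty)\to\mathbf{C}$ be a continuous, locally integrable function and suppose that $\mu$ is a causal Lorentz invariant Borel complex measure on Minkowski space with spectrum $\sigma$, i.e. $$\mu(\Gamma)=\int_{m=0}^{\infty}\sigma(m)\,\Omega_m^{+}(\Gamma)\,dm\qquad\text{for all }\Gamma\in\mathcal{B}_0(\mathbf{R}^4).$$ Then for every $a>0$ and every $b>a$, $\sigma$ can be calculated from the formula $$\sigma(b)=\frac{3}{4\pi}\,b\,g_a'(b),$$ where $g_a:(a,\infty)\to\mathbf{C}$ is given by $$g_a(b)=\lim_{\epsilon\to0^+}\epsilon^{-3}\mu(\Gamma(a,b,\epsilon)).$$
   Context: $\mathcal{B}_0(\mathbf{R}^4)$ denotes the collection of relatively compact Borel subsets of $\mathbf{R}^4$. A Borel complex measure on Minkowski space is a map $\mu:\mathcal{B}_0(\mathbf{R}^4)\to\mathbf{C}$ such that for every $C\in\mathcal{B}_0(\mathbf{R}^4)$ its restriction to the Borel subsets of $C$ is a complex measure on $C$ in the usual sense. $\mathbf{R}^4$ carries the Minkowski form $p^2=(p^0)^2-(p^1)^2-(p^2)^2-(p^3)^2$, and $\vec p=\pi(p)=(p^1,p^2,p^3)$. For $m>0$ let $\omega_m(\vec p)=(m^2+|\vec p|^2)^{1/2}$, $H_m^{+}=\{p\in\mathbf{R}^4:p^2=m^2,\ p^0>0\}$, and $\Omega_m^{+}(\Gamma)=\int_{\pi(\Gamma\cap H_m^{+})}\frac{d\vec p}{\omega_m(\vec p)}$. For $m,\epsilon>0$ let $S(m,\epsilon)=\{p\in\mathbf{R}^4:p^2=m^2,\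 |\vec p|<\epsilon,\ p^0>0\}$, and for $0<a<b$ let $\Gamma(a,b,\epsilon)=\bigcup_{m\in(a,b)}S(m,\epsilon)$ (the hyperbolic cylinder). *)

theory Defs
  imports "HOL-Analysis.Analysis"
begin

text \<open>
  Minkowski space is \<^typ>\<open>real ^ 4\<close>. In the index type \<^typ>\<open>4\<close> the numeral \<open>0\<close> equals \<open>4\<close>, so
  \<open>p $ 0, p $ 1, p $ 2, p $ 3\<close> are the four distinct coordinates, \<open>p $ 0\<close> being the energy.
\<close>

definition mink_sq :: "real ^ 4 \<Rightarrow> real" where
  "mink_sq p = (p $ 0)\<^sup>2 - (p $ 1)\<^sup>2 - (p $ 2)\<^sup>2 - (p $ 3)\<^sup>2"

definition spatial :: "real ^ 4 \<Rightarrow> real ^ 3" where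
  "spatial p = vector [p $ 1, p $ 2, p $ 3]"

definition rel_compact_borel :: "'a::topological_space set set" where
  "rel_compact_borel = {\<Gamma> \<in> sets borel. compact (closure \<Gamma>)}"

text \<open>
  The series in countable additivity converges absolutely without further demand, as the union does
  not depend on the order of the sets.
\<close>

definition complex_measure_on :: "'a measure \<Rightarrow> ('a set \<Rightarrow> complex) \<Rightarrow> bool" where
  "complex_measure_on M \<mu> \<longleftrightarrow> \<mu> {} = 0 \<and>
     (\<forall>A :: nat \<Rightarrow> 'a set. range A \<subseteq> sets M \<longrightarrow> disjoint_family A \<longrightarrow>
        (\<lambda>i. \<mu> (A i)) sums \<mu> (\<Union>i. A i))"

text \<open>
  A set function \<open>\<mu>\<close> is total in HOL; only its values on \<^const>\<open>rel_compact_borel\<close> are ever constrained.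
\<close>

definition borel_complex_measure :: "((real ^ 4) set \<Rightarrow> complex) \<Rightarrow> bool" where
  "borel_complex_measure \<mu> \<longleftrightarrow>
     (\<forall>C \<in> rel_compact_borel. complex_measure_on (restrict_space borel C) \<mu>)"

definition proper_orthochronous_lorentz :: "(real ^ 4 ^ 4) set" where
  "proper_orthochronous_lorentz =
     {\<Lambda>. (\<forall>p. mink_sq (\<Lambda> *v p) = mink_sq p) \<and> det \<Lambda> = 1 \<and> \<Lambda> $ 0 $ 0 > 0}"

definition lorentz_invariant :: "((real ^ 4) set \<Rightarrow> complex) \<Rightarrow> bool" where
  "lorentz_invariant \<mu> \<longleftrightarrow>
     (\<forall>\<Lambda> \<in> proper_orthochronous_lorentz. \<forall>\<Gamma> \<in> rel_compact_borel.
        \<mu> ((*v) \<Lambda> ` \<Gamma>) = \<mu> \<Gamma>)"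

definition forward_cone :: "(real ^ 4) set" where
  "forward_cone = {p. mink_sq p \<ge> 0 \<and> p $ 0 \<ge> 0}"

text \<open>Causality: the support of \<open>\<mu>\<close> lies in the closed set \<^const>\<open>forward_cone\<close>.\<close>

definition causal :: "((real ^ 4) set \<Rightarrow> complex) \<Rightarrow> bool" where
  "causal \<mu> \<longleftrightarrow> (\<forall>\<Gamma> \<in> rel_compact_borel. \<Gamma> \<inter> forward_cone = {} \<longrightarrow> \<mu> \<Gamma> = 0)"

definition omega :: "real \<Rightarrow> real ^ 3 \<Rightarrow> real" where
  "omega m q = sqrt (m\<^sup>2 + (norm q)\<^sup>2)"

definition mass_shell :: "real \<Rightarrow> (real ^ 4) set" where
  "mass_shell m = {p. mink_sq p = m\<^sup>2 \<and> p $ 0 > 0}"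

definition Omega :: "real \<Rightarrow> (real ^ 4) set \<Rightarrow> real" where
  "Omega m \<Gamma> = (LINT q : spatial ` (\<Gamma> \<inter> mass_shell m) | lborel. 1 / omega m q)"

text \<open>
  Integrability is part of the definition because the Bochner integral of a non-integrable function
  is \<open>0\<close>.
\<close>

definition has_spectrum :: "((real ^ 4) set \<Rightarrow> complex) \<Rightarrow> (real \<Rightarrow> complex) \<Rightarrow> bool" where
  "has_spectrum \<mu> \<sigma> \<longleftrightarrow>
     (\<forall>\<Gamma> \<in> rel_compact_borel.
        set_integrable lborel {0<..} (\<lambda>m. \<sigma> m * complex_of_real (Omega m \<Gamma>)) \<and>
        \<mu> \<Gamma> = (LINT m : {0<..} | lborel. \<sigma> m * complex_of_real (Omega m \<Gamma>)))"

definition locally_integrable_on :: "real set \<Rightarrow> (real \<Rightarrow> complex) \<Rightarrow> bool" where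
  "locally_integrable_on U f \<longleftrightarrow> (\<forall>K. compact K \<and> K \<subseteq> U \<longrightarrow> set_integrable lborel K f)"

definition shell_cap :: "real \<Rightarrow> real \<Rightarrow> (real ^ 4) set" where
  "shell_cap m \<epsilon> = {p. mink_sq p = m\<^sup>2 \<and> norm (spatial p) < \<epsilon> \<and> p $ 0 > 0}"

definition hyperbolic_cylinder :: "real \<Rightarrow> real \<Rightarrow> real \<Rightarrow> (real ^ 4) set" where
  "hyperbolic_cylinder a b \<epsilon> = (\<Union>m\<in>{a<..<b}. shell_cap m \<epsilon>)"

definition scaled_cylinder_measure ::
    "((real ^ 4) set \<Rightarrow> complex) \<Rightarrow> real \<Rightarrow> real \<Rightarrow> real \<Rightarrow> complex" where
  "scaled_cylinder_measure \<mu> a b \<epsilon> =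
     complex_of_real (\<epsilon> powi (-3)) * \<mu> (hyperbolic_cylinder a b \<epsilon>)"

text \<open>\<^const>\<open>Lim\<close> is unspecified if the limit does not exist, so existence must be stated separately.\<close>

definition cylinder_density :: "((real ^ 4) set \<Rightarrow> complex) \<Rightarrow> real \<Rightarrow> real \<Rightarrow> complex" where
  "cylinder_density \<mu> a b = Lim (at_right 0) (scaled_cylinder_measure \<mu> a b)"

end

theory Submission
  imports Defs
begin

text \<open>
  The cylinder meets the mass shell \<open>H\<^sub>m\<close> in the cap over the ball of radius \<open>\<epsilon>\<close> if \<open>a < m < b\<close>,
  and nowhere otherwise. On that ball \<open>m \<le> \<omega>\<^sub>m \<le> m + \<epsilon>\<close>, so \<open>\<epsilon>\<^sup>-\<^sup>3 \<Omega>\<^sub>m\<close> converges to \<open>4\<pi>/(3m)\<close> with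
  error at most \<open>4\<pi>\<epsilon>/(3a\<^sup>2)\<close>. The error being uniform in \<open>m\<close>, the limit may be taken under the integral:
  \<open>g\<^sub>a(b) = 4\<pi>/3 \<integral>\<^sub>a\<^sup>b \<sigma>(m)/m dm\<close>, and the fundamental theorem of calculus inverts this.
\<close>

lemma norm_vec3: "norm (q :: real ^ 3) = sqrt ((q $ 1)\<^sup>2 + (q $ 2)\<^sup>2 + (q $ 3)\<^sup>2)"
  by (simp add: norm_vec_def L2_set_def sum_3)

lemma norm_spatial_sq: "(norm (spatial p))\<^sup>2 = (p $ 1)\<^sup>2 + (p $ 2)\<^sup>2 + (p $ 3)\<^sup>2"
  by (simp add: norm_vec3 spatial_def)

lemma mink_sq_spatial: "mink_sq p = (p $ 0)\<^sup>2 - (norm (spatial p))\<^sup>2"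
  by (simp add: mink_sq_def norm_spatial_sq)

lemma ex_energy_spatial: "\<exists>p. p $ 0 = e \<and> spatial p = q"
proof -
  define p :: "real ^ 4" where
    "p = (\<chi> i. if i = 1 then q $ 1 else if i = 2 then q $ 2 else if i = 3 then q $ 3 else e)"
  have "p $ 0 = e" "p $ 1 = q $ 1" "p $ 2 = q $ 2" "p $ 3 = q $ 3"
    by (simp_all add: p_def)
  then show ?thesis
    by (auto simp: spatial_def vec_eq_iff forall_3 intro!: exI[of _ p])
qed

text \<open>The mass of a point is recovered as \<open>sqrt (mink_sq p)\<close>, so the union turns
  into strict inequalities between continuous functions. The upper bound keeps the root because
  \<open>b\<close> may be negative: squaring it could then admit points although the cylinder is
  empty.\<close>

lemma hyperbolic_cylinder_eq:
  assumes "a > 0"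
  shows "hyperbolic_cylinder a b \<epsilon> =
    {p. p $ 0 > 0 \<and> a\<^sup>2 < mink_sq p \<and> sqrt (mink_sq p) < b \<and> norm (spatial p) < \<epsilon>}"
proof (intro equalityI subsetI)
  fix p assume "p \<in> hyperbolic_cylinder a b \<epsilon>"
  then obtain m where m: "a < m" "m < b" "p \<in> shell_cap m \<epsilon>"
    by (auto simp: hyperbolic_cylinder_def)
  moreover have "a\<^sup>2 < m\<^sup>2"
    using m assms by (intro power_strict_mono) auto
  ultimately show "p \<in> {p. p $ 0 > 0 \<and> a\<^sup>2 < mink_sq p \<and> sqrt (mink_sq p) < b \<and> norm (spatial p) < \<epsilon>}"
    using assms by (auto simp: shell_cap_def)
next
  fix p assume p: "p \<in> {p. p $ 0 > 0 \<and> a\<^sup>2 < mink_sq p \<and> sqrt (mink_sq p) < b \<and> norm (spatial p) < \<epsilon>}"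
  then have "mink_sq p = (sqrt (mink_sq p))\<^sup>2"
    using zero_le_power2[of a] by (metis (mono_tags, lifting) less_imp_le mem_Collect_eq order_trans real_sqrt_pow2)
  moreover have "a < sqrt (mink_sq p)"
    using p assms by (auto intro: real_less_rsqrt)
  ultimately show "p \<in> hyperbolic_cylinder a b \<epsilon>"
    using p by (auto simp: hyperbolic_cylinder_def shell_cap_def intro!: bexI[of _ "sqrt (mink_sq p)"])
qed

lemma continuous_on_norm_spatial [continuous_intros]: "continuous_on A (\<lambda>p. norm (spatial p))"
  by (simp add: norm_vec3 spatial_def) (intro continuous_intros)

lemma hyperbolic_cylinder_rel_compact_borel:
  assumes "a > 0"
  shows "hyperbolic_cylinder a b \<epsilon> \<in> rel_compact_borel"
proof -
  have "open (hyperbolic_cylinder a b \<epsilon>)"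
    unfolding hyperbolic_cylinder_eq[OF assms] mink_sq_spatial
    by (intro open_Collect_conj open_Collect_less continuous_intros)
  moreover have "bounded (hyperbolic_cylinder a b \<epsilon>)"
  proof (rule boundedI)
    fix p assume p: "p \<in> hyperbolic_cylinder a b \<epsilon>"
    \<comment> \<open>\<open>sum_4\<close> produces the index 4, which is the energy index 0 in this
      type.\<close>
    have z: "(0::4) = 4" by simp
    have "(norm p)\<^sup>2 = (p $ 0)\<^sup>2 + (norm (spatial p))\<^sup>2"
      unfolding norm_spatial_sq by (simp add: norm_vec_def L2_set_def sum_4 z)
    \<comment> \<open>The Euclidean square exceeds the Minkowski square by twice the spatial square,
      and the cylinder bounds both quantities.\<close>
    also have "\<dots> = (sqrt (mink_sq p))\<^sup>2 + 2 * (norm (spatial p))\<^sup>2"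
    proof -
      have "mink_sq p > 0"
        using p assms unfolding hyperbolic_cylinder_eq[OF assms]
        by (auto intro: less_trans[of 0 "a\<^sup>2"])
      then show ?thesis
        by (simp add: mink_sq_spatial)
    qed
    also have "\<dots> \<le> b\<^sup>2 + 2 * \<epsilon>\<^sup>2"
    proof -
      \<comment> \<open>Squared roots must survive simplification for \<open>power_mono\<close> to
        apply, hence the deleted rules.\<close>
      have "(sqrt (mink_sq p))\<^sup>2 \<le> b\<^sup>2" "(norm (spatial p))\<^sup>2 \<le> \<epsilon>\<^sup>2"
        using p order_trans[OF zero_le_power2 less_imp_le, of a "mink_sq p"]
        unfolding hyperbolic_cylinder_eq[OF assms]
        by (auto intro!: power_mono simp del: real_sqrt_pow2_iff real_sqrt_pow2)
      then show ?thesis by linarith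
    qed
    finally show "norm p \<le> sqrt (b\<^sup>2 + 2 * \<epsilon>\<^sup>2)"
      by (rule real_le_rsqrt)
  qed
  ultimately show ?thesis
    by (simp add: rel_compact_borel_def)
qed

text \<open>Over each \<open>q\<close> the shell has exactly one point, of energy
  \<open>omega m q\<close>, and shells of distinct positive masses are disjoint.\<close>

lemma spatial_cylinder_shell:
  assumes "a > 0" "m > 0"
  shows "spatial ` (hyperbolic_cylinder a b \<epsilon> \<inter> mass_shell m) =
    (if a < m \<and> m < b then ball 0 \<epsilon> else {})"
proof (cases "a < m \<and> m < b")
  case True
  have "q \<in> spatial ` (hyperbolic_cylinder a b \<epsilon> \<inter> mass_shell m)" if "norm q < \<epsilon>" for q
  proof -
    obtain p where p: "p $ 0 = sqrt (m\<^sup>2 + (norm q)\<^sup>2)" "spatial p = q"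
      using ex_energy_spatial by blast
    moreover have "m\<^sup>2 + (norm q)\<^sup>2 > 0"
      using assms by (simp add: add_pos_nonneg)
    ultimately have "p \<in> shell_cap m \<epsilon>" "p \<in> mass_shell m"
      using that by (auto simp: shell_cap_def mass_shell_def mink_sq_spatial)
    then show ?thesis
      using True p by (auto simp: hyperbolic_cylinder_def intro!: image_eqI[of _ _ p])
  qed
  then show ?thesis
    using True by (auto simp: hyperbolic_cylinder_def shell_cap_def)
next
  case False
  have "m' = m" if "m'\<^sup>2 = m\<^sup>2" "a < m'" for m'
    using that assms by (simp add: power2_eq_iff_nonneg)
  with False show ?thesis
    by (fastforce simp: hyperbolic_cylinder_def shell_cap_def mass_shell_def)
qed

lemma Omega_cylinder_outside:
  assumes "a > 0" "m > 0" "\<not> (a < m \<and> m < b)"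
  shows "Omega m (hyperbolic_cylinder a b \<epsilon>) = 0"
  using assms unfolding Omega_def spatial_cylinder_shell[OF assms(1,2)]
  by (auto simp: set_lebesgue_integral_def)

lemma Omega_cylinder_approx:
  assumes "a > 0" "a < m" "m < b" "\<epsilon> > 0"
  shows "\<bar>\<epsilon> powi (-3) * Omega m (hyperbolic_cylinder a b \<epsilon>) - 4 / 3 * pi / m\<bar> \<le> 4 / 3 * pi * \<epsilon> / a\<^sup>2"
proof -
  let ?B = "ball 0 \<epsilon> :: (real ^ 3) set"
  define I where "I = Omega m (hyperbolic_cylinder a b \<epsilon>)"
  have m: "m > 0" using assms by simp
  have I: "I = (LINT q : ?B | lborel. 1 / omega m q)"
    using assms spatial_cylinder_shell[OF assms(1) m, of b \<epsilon>] by (simp add: I_def Omega_def)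
  have vol: "measure lborel ?B = 4 / 3 * pi * \<epsilon> ^ 3"
    using assms content_ball[of \<epsilon> "0 :: real ^ 3"] by (simp add: unit_ball_vol_3)
  have bounds: "m \<le> omega m q" "q \<in> ?B \<Longrightarrow> omega m q \<le> m + \<epsilon>" for q
  proof -
    show "m \<le> omega m q"
      unfolding omega_def by (rule real_le_rsqrt) simp
    show "omega m q \<le> m + \<epsilon>" if "q \<in> ?B"
      using sqrt_sum_squares_le_sum[of m "norm q"] m that by (simp add: omega_def)
  qed
  then have pos: "omega m q > 0" for q
    using m by (metis less_le_trans)
  \<comment> \<open>The closed ball is compact, and the integrand is continuous on it because
    \<open>omega\<close> is bounded below by \<open>m > 0\<close>.\<close>
  have int: "set_integrable lborel ?B (\<lambda>q. 1 / omega m q)"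
  proof (rule set_integrable_subset)
    have "continuous_on (cball 0 \<epsilon>) (\<lambda>q :: real ^ 3. 1 / omega m q)"
      using pos unfolding omega_def by (intro continuous_intros) (metis less_irrefl)+
    then show "set_integrable lborel (cball 0 \<epsilon>) (\<lambda>q :: real ^ 3. 1 / omega m q)"
      unfolding set_integrable_def by (intro borel_integrable_compact) auto
  qed auto
  have const: "set_integrable lborel ?B (\<lambda>q. c)" "(LINT q : ?B | lborel. c) = 4 / 3 * pi * \<epsilon> ^ 3 * c"
    for c :: real
    using vol emeasure_lborel_ball_finite[of "0 :: real ^ 3" \<epsilon>]
    by (auto simp: set_integrable_def set_lebesgue_integral_def)
  have "I \<le> 4 / 3 * pi * \<epsilon> ^ 3 * (1 / m)"
    unfolding I const(2)[symmetric] using bounds m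
    by (intro set_integral_mono int const) (auto intro!: divide_left_mono mult_pos_pos pos)
  then have upper: "\<epsilon> powi (-3) * I \<le> 4 / 3 * pi / m"
    using assms by (simp add: power_int_minus field_simps)
  have "4 / 3 * pi * \<epsilon> ^ 3 * (1 / (m + \<epsilon>)) \<le> I"
    unfolding I const(2)[symmetric] using bounds m assms
    by (intro set_integral_mono int const) (auto intro!: divide_left_mono mult_pos_pos pos)
  then have lower: "4 / 3 * pi / (m + \<epsilon>) \<le> \<epsilon> powi (-3) * I"
    using assms m by (simp add: power_int_minus field_simps)
  \<comment> \<open>The error is at most the gap between the two bounds. Estimating
    \<open>m * (m + \<epsilon>)\<close> below by the square of \<open>a\<close> removes the
    dependence on \<open>m\<close>.\<close>
  have "4 / 3 * pi / m - 4 / 3 * pi / (m + \<epsilon>) = 4 / 3 * pi * \<epsilon> / (m * (m + \<epsilon>))"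
    using m assms by (simp add: field_simps)
  also have "\<dots> \<le> 4 / 3 * pi * \<epsilon> / a\<^sup>2"
    using m assms unfolding power2_eq_square
    by (intro divide_left_mono mult_mono mult_pos_pos) auto
  finally show ?thesis
    using upper lower unfolding I_def by linarith
qed

text \<open>No order between \<open>a\<close> and \<open>b\<close> is assumed: for
  \<open>b \<le> a\<close> the cylinder is empty and both sides vanish. Hence the limit is known for
  every real second argument.\<close>

lemma scaled_cylinder_measure_tendsto:
  assumes \<sigma>: "continuous_on {0<..} \<sigma>" and spec: "has_spectrum \<mu> \<sigma>" and a: "a > 0"
  shows "(scaled_cylinder_measure \<mu> a b \<longlongrightarrow>
    (4 / 3 * pi) *\<^sub>R integral {a..b} (\<lambda>m. \<sigma> m / of_real m)) (at_right 0)"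
proof -
  let ?L = "\<lambda>m. \<sigma> m * of_real (4 / 3 * pi / m)"
  define K where "K = (LINT m : {a<..<b} | lborel. norm (\<sigma> m))"
  \<comment> \<open>Since \<open>a > 0\<close>, the closed interval stays inside the domain of
    continuity.\<close>
  have intgr: "set_integrable lborel {a<..<b} f" if "continuous_on {0<..} f"
    for f :: "real \<Rightarrow> complex"
  proof (rule set_integrable_subset)
    show "set_integrable lborel {a..b} f"
      using a by (intro borel_integrable_atLeastAtMost' continuous_on_subset[OF that]) auto
  qed auto
  have "continuous_on {0<..} ?L"
    using \<sigma> by (intro continuous_intros) auto
  note intL = intgr[OF this]
  \<comment> \<open>The endpoints are negligible; the gauge integral over the closed interval is the
    form that the fundamental theorem of calculus needs.\<close>
  have "(LINT m : {a<..<b} | lborel. ?L m) = integral {a..b} ?L"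
    using set_borel_integral_eq_integral(2)[OF intL] by (simp add: integral_open_interval_real)
  also have "\<dots> = integral {a..b} (\<lambda>m. (4 / 3 * pi) *\<^sub>R (\<sigma> m / of_real m))"
    by (intro integral_cong) (simp add: scaleR_conv_of_real)
  finally have L: "(LINT m : {a<..<b} | lborel. ?L m) =
      (4 / 3 * pi) *\<^sub>R integral {a..b} (\<lambda>m. \<sigma> m / of_real m)"
    by simp
  have bound: "norm (scaled_cylinder_measure \<mu> a b \<epsilon> - (LINT m : {a<..<b} | lborel. ?L m))
      \<le> K * (4 / 3 * pi * \<epsilon> / a\<^sup>2)" if \<epsilon>: "\<epsilon> > 0" for \<epsilon>
  proof -
    let ?O = "\<lambda>m. Omega m (hyperbolic_cylinder a b \<epsilon>)"
    let ?F = "\<lambda>m. \<sigma> m * of_real (\<epsilon> powi (-3) * ?O m)"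
    have sp: "set_integrable lborel {0<..} (\<lambda>m. \<sigma> m * of_real (?O m))"
      "\<mu> (hyperbolic_cylinder a b \<epsilon>) = (LINT m : {0<..} | lborel. \<sigma> m * of_real (?O m))"
      using spec hyperbolic_cylinder_rel_compact_borel[OF a, of b \<epsilon>] unfolding has_spectrum_def by blast+
    \<comment> \<open>With the scalar in front, integrability follows from that of the spectral
      integrand.\<close>
    have F: "?F = (\<lambda>m. of_real (\<epsilon> powi (-3)) * (\<sigma> m * of_real (?O m)))"
      by (auto simp: mult_ac)
    have intF: "set_integrable lborel {a<..<b} ?F"
      unfolding F using a by (intro set_integrable_mult_right set_integrable_subset[OF sp(1)]) auto
    have "(LINT m : {0<..} | lborel. \<sigma> m * of_real (?O m)) =
        (LINT m : {a<..<b} | lborel. \<sigma> m * of_real (?O m))"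
      unfolding set_lebesgue_integral_def using a
      by (intro Bochner_Integration.integral_cong)
        (auto simp: indicator_def Omega_cylinder_outside)
    then have "scaled_cylinder_measure \<mu> a b \<epsilon> = (LINT m : {a<..<b} | lborel. ?F m)"
      unfolding F by (simp add: scaled_cylinder_measure_def sp(2))
    then have "norm (scaled_cylinder_measure \<mu> a b \<epsilon> - (LINT m : {a<..<b} | lborel. ?L m)) =
        norm (LINT m : {a<..<b} | lborel. ?F m - ?L m)"
      using intF intL by simp
    also have "\<dots> \<le> (LINT m : {a<..<b} | lborel. norm (?F m - ?L m))"
      using intF intL by (intro set_integral_norm_bound set_integral_diff)
    also have "\<dots> \<le> (LINT m : {a<..<b} | lborel. norm (\<sigma> m) * (4 / 3 * pi * \<epsilon> / a\<^sup>2))"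
    proof (rule set_integral_mono)
      show "set_integrable lborel {a<..<b} (\<lambda>m. norm (?F m - ?L m))"
        using intF intL by (intro set_integrable_norm set_integral_diff)
      show "set_integrable lborel {a<..<b} (\<lambda>m. norm (\<sigma> m) * (4 / 3 * pi * \<epsilon> / a\<^sup>2))"
        by (intro set_integrable_mult_left set_integrable_norm intgr \<sigma>)
      fix m assume m: "m \<in> {a<..<b}"
      \<comment> \<open>Factoring out \<open>\<sigma> m\<close> leaves a real difference, to which
        the uniform shell estimate applies.\<close>
      have "norm (?F m - ?L m) = norm (\<sigma> m) * \<bar>\<epsilon> powi (-3) * ?O m - 4 / 3 * pi / m\<bar>"
        by (simp only: right_diff_distrib[symmetric] of_real_diff[symmetric] norm_mult norm_of_real)
      also have "\<dots> \<le> norm (\<sigma> m) * (4 / 3 * pi * \<epsilon> / a\<^sup>2)"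
        using m a \<epsilon> by (intro mult_left_mono Omega_cylinder_approx) auto
      finally show "norm (?F m - ?L m) \<le> norm (\<sigma> m) * (4 / 3 * pi * \<epsilon> / a\<^sup>2)" .
    qed
    also have "\<dots> = K * (4 / 3 * pi * \<epsilon> / a\<^sup>2)"
      by (simp only: K_def set_integral_mult_left)
    finally show ?thesis .
  qed
  have "((\<lambda>\<epsilon>. K * (4 / 3 * pi * \<epsilon> / a\<^sup>2)) \<longlongrightarrow> K * (4 / 3 * pi * 0 / a\<^sup>2)) (at_right 0)"
    using a by (intro tendsto_intros) auto
  then have "((\<lambda>\<epsilon>. scaled_cylinder_measure \<mu> a b \<epsilon> - (LINT m : {a<..<b} | lborel. ?L m)) \<longlongrightarrow> 0)
      (at_right 0)"
    by (intro Lim_null_comparison[OF eventually_mono[OF eventually_at_right_less bound]]) simp_all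
  then show ?thesis
    unfolding L by (simp add: Lim_null[symmetric])
qed

theorem theorem2:
  fixes \<sigma> :: "real \<Rightarrow> complex"
    and \<mu> :: "(real ^ 4) set \<Rightarrow> complex"
  assumes "continuous_on {0<..} \<sigma>"
    and "locally_integrable_on {0<..} \<sigma>"
    and "borel_complex_measure \<mu>"
    and "causal \<mu>"
    and "lorentz_invariant \<mu>"
    and "has_spectrum \<mu> \<sigma>"
  shows "\<forall>a>0. \<forall>b>a.
    (scaled_cylinder_measure \<mu> a b \<longlongrightarrow> cylinder_density \<mu> a b) (at_right 0) \<and>
    cylinder_density \<mu> a differentiable (at b) \<and>
    \<sigma> b = complex_of_real (3 / (4 * pi) * b) * vector_derivative (cylinder_density \<mu> a) (at b)"
proof (intro allI impI)
  fix a b :: real assume a: "0 < a" and b: "a < b"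
  let ?f = "\<lambda>m. \<sigma> m / of_real m"
  note lim = scaled_cylinder_measure_tendsto[OF assms(1,6) a]
  \<comment> \<open>Having this for all \<open>c\<close> gives an equality of functions, which is
    what gets differentiated.\<close>
  have g: "cylinder_density \<mu> a c = (4 / 3 * pi) *\<^sub>R integral {a..c} ?f" for c
    unfolding cylinder_density_def by (rule tendsto_Lim[OF trivial_limit_at_right_real lim])
  \<comment> \<open>Extending the interval past \<open>b\<close> makes \<open>b\<close> an interior
    point, so the derivative within the interval is the full derivative.\<close>
  have "continuous_on {a..b + 1} ?f"
    using a by (intro continuous_intros continuous_on_subset[OF assms(1)]) auto
  then have "((\<lambda>c. integral {a..c} ?f) has_vector_derivative ?f b) (at b within {a..b + 1})"
    using b by (intro integral_has_vector_derivative) auto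
  then have "((\<lambda>c. integral {a..c} ?f) has_vector_derivative ?f b) (at b)"
    using b by (simp add: at_within_Icc_at)
  then have deriv: "(cylinder_density \<mu> a has_vector_derivative (4 / 3 * pi) *\<^sub>R ?f b) (at b)"
    unfolding g[abs_def]
    by (rule bounded_linear.has_vector_derivative[OF bounded_linear_scaleR_right])
  have "\<sigma> b = of_real (3 / (4 * pi) * b) * ((4 / 3 * pi) *\<^sub>R ?f b)"
    using a b by (simp add: scaleR_conv_of_real)
  then show "(scaled_cylinder_measure \<mu> a b \<longlongrightarrow> cylinder_density \<mu> a b) (at_right 0) \<and>
    cylinder_density \<mu> a differentiable (at b) \<and>
    \<sigma> b = complex_of_real (3 / (4 * pi) * b) * vector_derivative (cylinder_density \<mu> a) (at b)"
    using lim[of b] deriv by (auto simp: g vector_derivative_at intro: differentiableI_vector)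
qed

end
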